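(* Let $\alpha\in(0,1)$ and $U=\prod_{i=1}^d[0,b_i]\subset\mathbb{R}^d$ with all $b_i>0$. Let $\pi_\alpha:\Omega_\alpha^\bullet(U;\mathscr{P}_\alpha)\to\Omega_\alpha^\bullet(U;\mathscr{P}_\alpha)$ be the projection onto constant $0$-forms (a polynomial $0$-form is sent to its constant term, i.e. all monomials of positive degree are sent to $0$), and zero on all positive form degrees. Then $$d^\alpha K_\alpha+K_\alpha d^\alpha=\mathrm{id}-\pi_\alpha.$$ Consequently, $$H^0\bigl(\Omega_\alpha^\bullet(U;\mathscr{P}_\alpha),d^\alpha\bigr)\simeq\mathbb{R},\qquad H^p\bigl(\Omega_\alpha^\bullet(U;\mathscr{P}_\alpha),d^\alpha\bigr)=0\quad(p\ge1).$$
   Context: Let $X_i^\alpha(x)=x_i^\alpha/\Gamma(1+\alpha)$ and $\mathscr{P}_\alpha(U)=\mathbb{R}[X_1^\alpha,\dots,X_d^\alpha]$, the algebra of functions on $U$ generated by the $X_i^\alpha$. These functions are algebraically independent, so each element is uniquely a finite linear combination of monomials. The polynomial Caputo operator $\mathsf{D}_i^\alpha:\mathscr{P}_\alpha(U)\to\mathscr{P}_\alpha(U)$ is the $\mathbb{R}$-linear map defined on monomials $M=\prod_{k=1}^d(X_k^\alpha)^{m_k}$, $m_k\in\mathbb{Z}_{\ge0}$, by $$\mathsf{D}_i^\alpha M=\frac{\Gamma(m_i\alpha+1)}{\Gamma((m_i-1)\alpha+1)\Gamma(1+\alpha)}(X_i^\alpha)^{m_i-1}\prod_{j\ne i}(X_j^\alpha)^{m_j}\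 \text{ if } m_i\ge1,\qquad \mathsf{D}_i^\alpha M=0\ \text{ if } m_i=0.$$ Let $d^\alpha X_1,\dots,d^\alpha X_d$ be formal degree-one generators with $d^\alpha X_i\wedge d^\alpha X_j=-d^\alpha X_j\wedge d^\alpha X_i$ and $d^\alpha X_i\wedge d^\alpha X_i=0$. For $I=(i_1<\dots<i_p)$ put $d^\alpha X_I=d^\alpha X_{i_1}\wedge\cdots\wedge d^\alpha X_{i_p}$, $\Omega_\alpha^p(U;\mathscr{P}_\alpha)=\bigoplus_{|I|=p}\mathscr{P}_\alpha(U)\,d^\alpha X_I$ and $\Omega_\alpha^\bullet=\bigoplus_{p=0}^d\Omega_\alpha^p$ (the exterior algebra over $\mathscr{P}_\alpha(U)$ on these generators). The fractional exterior differential, which satisfies $(d^\alpha)^2=0$, is $$d^\alpha\Bigl(\sum_{|I|=p}a_I\,d^\alpha X_I\Bigr)=\sum_{|I|=p}\sum_{i=1}^d(\mathsf{D}_i^\alpha a_I)\,d^\alpha X_i\wedge d^\alpha X_I .$$ Homotopy operator: for $m\in\mathbb{Z}_{\ge0}$ let $\phi(m)=\frac{1}{m!}\frac{\Gamma(m\alpha+1)}{\Gamma(1+\alpha)^m}$ (so $\phi(0)=1$). For a multi-index $\mathbf{m}=(m_1,\dots,m_d)$ let $\phi(\mathbf{m})=\prod_j\phi(m_j)$, $(X^\alpha)^{\mathbf{m}}=\prod_j(X_j^\alpha)^{m_j}$, $|\mathbf{m}|=m_1+\dots+m_d$, and let $e_j$ be the $j$-th standard multi-index. $K_\alpha$ is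 the $\mathbb{R}$-linear operator on $\Omega_\alpha^\bullet(U;\mathscr{P}_\alpha)$ that is $0$ on $0$-forms and, for $p\ge1$ and $i_1<\dots<i_p$, is given on $\omega=(X^\alpha)^{\mathbf{m}}\,d^\alpha X_{i_1}\wedge\cdots\wedge d^\alpha X_{i_p}$ by $$K_\alpha\omega=\frac{1}{|\mathbf{m}|+p}\sum_{r=1}^p(-1)^{r-1}\frac{\phi(\mathbf{m})}{\phi(\mathbf{m}+e_{i_r})}(X^\alpha)^{\mathbf{m}+e_{i_r}}\,d^\alpha X_{i_1}\wedge\cdots\widehat{d^\alpha X_{i_r}}\cdots\wedge d^\alpha X_{i_p},$$ where the hat denotes omission. *)

theory Defs
  imports "HOL-Analysis.Analysis" "HOL-Library.Function_Algebras"
begin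

text \<open>
  The index type \<open>'n\<close> plays the role of \<open>{1, \<dots>, d}\<close>. A function on \<open>U\<close> is represented by a
  function on the whole space that vanishes outside \<open>U\<close>, so that equality of representatives is
  equality on \<open>U\<close>. Sums, differences and products of functions are the pointwise ones of
  \<open>HOL-Library.Function_Algebras\<close>.
\<close>

definition fconst :: "(real^'n) set \<Rightarrow> real \<Rightarrow> real^'n \<Rightarrow> real" where
  "fconst U c = (\<lambda>x. if x \<in> U then c else 0)"

definition frac_coord :: "real \<Rightarrow> (real^'n) set \<Rightarrow> 'n \<Rightarrow> real^'n \<Rightarrow> real" where
  "frac_coord \<alpha> U i = (\<lambda>x. if x \<in> U then (x $ i) powr \<alpha> / Gamma (1 + \<alpha>) else 0)"

inductive_set frac_poly :: "real \<Rightarrow> (real^'n) set \<Rightarrow> (real^'n \<Rightarrow> real) set"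
  for \<alpha> :: real and U :: "(real^'n) set" where
  const: "fconst U c \<in> frac_poly \<alpha> U"
| coord: "frac_coord \<alpha> U i \<in> frac_poly \<alpha> U"
| add: "f \<in> frac_poly \<alpha> U \<Longrightarrow> g \<in> frac_poly \<alpha> U \<Longrightarrow> f + g \<in> frac_poly \<alpha> U"
| mult: "f \<in> frac_poly \<alpha> U \<Longrightarrow> g \<in> frac_poly \<alpha> U \<Longrightarrow> f * g \<in> frac_poly \<alpha> U"

definition frac_monom :: "real \<Rightarrow> (real^'n) set \<Rightarrow> ('n \<Rightarrow> nat) \<Rightarrow> real^'n \<Rightarrow> real" where
  "frac_monom \<alpha> U m = (\<lambda>x. if x \<in> U then \<Prod>i\<in>UNIV. frac_coord \<alpha> U i x ^ m i else 0)"

text \<open>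
  The coefficients of the expansion into monomials. They are meaningful for elements of
  \<open>frac_poly \<alpha> U\<close> because the generators are algebraically independent (when \<open>U\<close> is a
  nondegenerate box).
\<close>

definition frac_coeff ::
    "real \<Rightarrow> (real^'n) set \<Rightarrow> (real^'n \<Rightarrow> real) \<Rightarrow> ('n \<Rightarrow> nat) \<Rightarrow> real" where
  "frac_coeff \<alpha> U f = (THE c. finite {m. c m \<noteq> 0} \<and>
     f = (\<lambda>x. \<Sum>m | c m \<noteq> 0. c m * frac_monom \<alpha> U m x))"

definition caputo_monom ::
    "real \<Rightarrow> (real^'n) set \<Rightarrow> 'n \<Rightarrow> ('n \<Rightarrow> nat) \<Rightarrow> real^'n \<Rightarrow> real" where
  "caputo_monom \<alpha> U i m =
     (if m i = 0 then 0
      else (\<lambda>x. Gamma (real (m i) * \<alpha> + 1) /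
                (Gamma ((real (m i) - 1) * \<alpha> + 1) * Gamma (1 + \<alpha>)) *
                frac_monom \<alpha> U (m(i := m i - 1)) x))"

definition caputo ::
    "real \<Rightarrow> (real^'n) set \<Rightarrow> 'n \<Rightarrow> (real^'n \<Rightarrow> real) \<Rightarrow> real^'n \<Rightarrow> real" where
  "caputo \<alpha> U i f =
     (\<lambda>x. \<Sum>m | frac_coeff \<alpha> U f m \<noteq> 0. frac_coeff \<alpha> U f m * caputo_monom \<alpha> U i m x)"

text \<open>
  A form is the family of its coefficients with respect to the basis \<open>d\<^sup>\<alpha>X\<^sub>I\<close>, where the
  increasing tuple \<open>I\<close> is encoded by its set of entries; \<open>form_term f I\<close> is \<open>f d\<^sup>\<alpha>X\<^sub>I\<close>.
\<close>

type_synonym 'n form = "'n set \<Rightarrow> real^'n \<Rightarrow> real"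

definition form_term :: "(real^'n \<Rightarrow> real) \<Rightarrow> 'n set \<Rightarrow> 'n form" where
  "form_term f I = (\<lambda>J. if J = I then f else 0)"

definition dX :: "(real^'n) set \<Rightarrow> 'n set \<Rightarrow> 'n form" where
  "dX U I = form_term (fconst U 1) I"

definition form_scale :: "real \<Rightarrow> 'n form \<Rightarrow> 'n form" where
  "form_scale c \<omega> = (\<lambda>I x. c * \<omega> I x)"

definition form_mult :: "(real^'n \<Rightarrow> real) \<Rightarrow> 'n form \<Rightarrow> 'n form" where
  "form_mult f \<omega> = (\<lambda>I. f * \<omega> I)"

definition forms :: "real \<Rightarrow> (real^'n) set \<Rightarrow> 'n form set" where
  "forms \<alpha> U = {\<omega>. \<forall>I. \<omega> I \<in> frac_poly \<alpha> U}"

definition forms_deg :: "real \<Rightarrow> (real^'n) set \<Rightarrow> nat \<Rightarrow> 'n form set" where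
  "forms_deg \<alpha> U p = {\<omega> \<in> forms \<alpha> U. \<forall>I. card I \<noteq> p \<longrightarrow> \<omega> I = 0}"

text \<open>
  The sign is that of the permutation sorting the concatenation of the increasing tuples \<open>I\<close> and
  \<open>K - I\<close>. The lemmas below give the products of basis elements, the
  defining relations of the generators and the description of \<open>d\<^sup>\<alpha>X\<^sub>I\<close> as an ordered wedge product of generators.
\<close>

definition wedge :: "'n::{finite,linorder} form \<Rightarrow> 'n form \<Rightarrow> 'n form" where
  "wedge \<omega> \<eta> = (\<lambda>K x. \<Sum>I\<in>Pow K.
     (- 1) ^ card {(i, j). i \<in> I \<and> j \<in> K - I \<and> j < i} * \<omega> I x * \<eta> (K - I) x)"

lemma wedge_dX:
  fixes U :: "(real^'n::{finite,linorder}) set"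
  shows "wedge (dX U I) (dX U J) =
    (if I \<inter> J = {} then form_scale ((- 1) ^ card {(i, j). i \<in> I \<and> j \<in> J \<and> j < i}) (dX U (I \<union> J))
     else 0)"
proof (intro ext)
  fix K :: "'n set" and x :: "(real, 'n) vec"
  let ?s = "\<lambda>A. (- 1 :: real) ^ card {(i, j). i \<in> A \<and> j \<in> K - A \<and> j < i}"
  have "wedge (dX U I) (dX U J) K x = (\<Sum>A\<in>Pow K. if A = I then
      ?s I * fconst U 1 x * (if K - I = J then fconst U 1 x else 0) else 0)"
    unfolding wedge_def dX_def form_term_def by (intro sum.cong) auto
  also have "\<dots> = (if I \<subseteq> K \<and> K - I = J then ?s I * fconst U 1 x else 0)"
    by (simp add: fconst_def)
  also have "\<dots> = (if I \<inter> J = {} then form_scale ((- 1) ^ card {(i, j). i \<in> I \<and> j \<in> J \<and> j < i})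
      (dX U (I \<union> J)) else 0) K x"
  proof (cases "I \<subseteq> K \<and> K - I = J")
    case True
    then have "I \<inter> J = {}" "K = I \<union> J" by auto
    with True show ?thesis by (simp add: form_scale_def dX_def form_term_def)
  next
    case False
    then have "\<not> (I \<inter> J = {} \<and> K = I \<union> J)" by auto
    with False show ?thesis by (auto simp add: form_scale_def dX_def form_term_def)
  qed
  finally show "wedge (dX U I) (dX U J) K x = (if I \<inter> J = {} then
      form_scale ((- 1) ^ card {(i, j). i \<in> I \<and> j \<in> J \<and> j < i}) (dX U (I \<union> J)) else 0) K x" .
qed

lemma wedge_dX_self:
  fixes U :: "(real^'n::{finite,linorder}) set"
  shows "wedge (dX U {i}) (dX U {i}) = 0"
  by (simp add: wedge_dX)

lemma wedge_dX_anticommute: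
  fixes U :: "(real^'n::{finite,linorder}) set"
  shows "wedge (dX U {i}) (dX U {j}) = - wedge (dX U {j}) (dX U {i})"
proof -
  have *: "{(a, b). a = i \<and> b = j \<and> b < a} = (if j < i then {(i, j)} else {})" for i j :: 'n
    by auto
  show ?thesis
    by (cases i j rule: linorder_cases)
      (auto simp: wedge_dX * form_scale_def fun_eq_iff insert_commute)
qed

lemma dX_eq_wedge_generators:
  fixes U :: "(real^'n::{finite,linorder}) set"
  shows "dX U I = foldr (\<lambda>i. wedge (dX U {i})) (sorted_list_of_set I) (dX U {})"
proof -
  have "foldr (\<lambda>i. wedge (dX U {i})) xs (dX U {}) = dX U (set xs)"
    if "sorted_wrt (<) xs" for xs
    using that
  proof (induction xs)
    case (Cons a xs)
    then have e: "{(i, j). i = a \<and> j \<in> set xs \<and> j < i} = {}" by (auto dest: less_asym)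
    from Cons show ?case by (auto simp: wedge_dX e form_scale_def)
  qed simp
  from this[of "sorted_list_of_set I"] show ?thesis by simp
qed

definition frac_d :: "real \<Rightarrow> (real^'n::{finite,linorder}) set \<Rightarrow> 'n form \<Rightarrow> 'n form" where
  "frac_d \<alpha> U \<omega> = (\<Sum>I\<in>UNIV. \<Sum>i\<in>UNIV.
     form_mult (caputo \<alpha> U i (\<omega> I)) (wedge (dX U {i}) (dX U I)))"

definition phi :: "real \<Rightarrow> nat \<Rightarrow> real" where
  "phi \<alpha> m = 1 / fact m * (Gamma (real m * \<alpha> + 1) / Gamma (1 + \<alpha>) ^ m)"

definition phi_multi :: "real \<Rightarrow> ('n::finite \<Rightarrow> nat) \<Rightarrow> real" where
  "phi_multi \<alpha> m = (\<Prod>j\<in>UNIV. phi \<alpha> (m j))"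

text \<open>
  Positions in the increasing list of \<open>I\<close> are counted from \<open>0\<close>, hence the sign \<open>(-1)\<^sup>r\<close>. For
  \<open>I = {}\<close> the sum is empty, so \<open>homotopy\<close> vanishes on \<open>0\<close>-forms.
\<close>

definition homotopy_term ::
    "real \<Rightarrow> (real^'n::{finite,linorder}) set \<Rightarrow> ('n \<Rightarrow> nat) \<Rightarrow> 'n set \<Rightarrow> 'n form" where
  "homotopy_term \<alpha> U m I =
     form_scale (1 / (real (\<Sum>j\<in>UNIV. m j) + real (card I)))
       (\<Sum>r<card I.
          let i = sorted_list_of_set I ! r; m' = m(i := m i + 1) in
          form_scale ((- 1) ^ r * (phi_multi \<alpha> m / phi_multi \<alpha> m'))
            (form_term (frac_monom \<alpha> U m') (I - {i})))"

definition homotopy :: "real \<Rightarrow> (real^'n::{finite,linorder}) set \<Rightarrow> 'n form \<Rightarrow> 'n form" where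
  "homotopy \<alpha> U \<omega> = (\<Sum>I\<in>UNIV. \<Sum>m | frac_coeff \<alpha> U (\<omega> I) m \<noteq> 0.
     form_scale (frac_coeff \<alpha> U (\<omega> I) m) (homotopy_term \<alpha> U m I))"

definition const_proj :: "real \<Rightarrow> (real^'n) set \<Rightarrow> 'n form \<Rightarrow> 'n form" where
  "const_proj \<alpha> U \<omega> = form_term (fconst U (frac_coeff \<alpha> U (\<omega> {}) (\<lambda>_. 0))) {}"

definition cocycles :: "real \<Rightarrow> (real^'n::{finite,linorder}) set \<Rightarrow> nat \<Rightarrow> 'n form set" where
  "cocycles \<alpha> U p = {\<omega> \<in> forms_deg \<alpha> U p. frac_d \<alpha> U \<omega> = 0}"

fun coboundaries :: "real \<Rightarrow> (real^'n::{finite,linorder}) set \<Rightarrow> nat \<Rightarrow> 'n form set" where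
  "coboundaries \<alpha> U 0 = {0}"
| "coboundaries \<alpha> U (Suc p) = frac_d \<alpha> U ` forms_deg \<alpha> U p"

definition cohom_rel ::
    "real \<Rightarrow> (real^'n::{finite,linorder}) set \<Rightarrow> nat \<Rightarrow> ('n form \<times> 'n form) set" where
  "cohom_rel \<alpha> U p = {(\<omega>, \<eta>). \<omega> \<in> cocycles \<alpha> U p \<and> \<eta> \<in> cocycles \<alpha> U p \<and>
     \<omega> - \<eta> \<in> coboundaries \<alpha> U p}"

definition cohomology :: "real \<Rightarrow> (real^'n::{finite,linorder}) set \<Rightarrow> nat \<Rightarrow> 'n form set set" where
  "cohomology \<alpha> U p = cocycles \<alpha> U p // cohom_rel \<alpha> U p"

definition cohom_zero :: "real \<Rightarrow> (real^'n::{finite,linorder}) set \<Rightarrow> nat \<Rightarrow> 'n form set" where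
  "cohom_zero \<alpha> U p = cohom_rel \<alpha> U p `` {0}"

definition cohom_add ::
    "real \<Rightarrow> (real^'n::{finite,linorder}) set \<Rightarrow> nat \<Rightarrow> 'n form set \<Rightarrow> 'n form set \<Rightarrow> 'n form set" where
  "cohom_add \<alpha> U p A B = (\<Union>\<omega>\<in>A. \<Union>\<eta>\<in>B. cohom_rel \<alpha> U p `` {\<omega> + \<eta>})"

definition cohom_scale ::
    "real \<Rightarrow> (real^'n::{finite,linorder}) set \<Rightarrow> nat \<Rightarrow> real \<Rightarrow> 'n form set \<Rightarrow> 'n form set" where
  "cohom_scale \<alpha> U p c A = (\<Union>\<omega>\<in>A. cohom_rel \<alpha> U p `` {form_scale c \<omega>})"

end

theory Submission
  imports Defs
begin

text \<open>
  Rescale the monomial basis to \<open>e\<^sub>m = (X\<^sup>\<alpha>)\<^sup>m / \<phi>(m)\<close>. The quotient of Gamma values in the Caputo rule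
  is \<open>m\<^sub>i \<phi>(m\<^sub>i) / \<phi>(m\<^sub>i - 1)\<close>, so \<open>D\<^sub>i\<close> maps \<open>e\<^sub>m\<close> to \<open>m\<^sub>i\<close> times the rescaled monomial whose
  \<open>i\<close>-th exponent is lowered by one: in this basis the Caputo operators are the ordinary partial
  derivatives of polynomials, and the homotopy operator is contraction with the Euler field,
  divided by the total weight \<open>|m| + p\<close>. All traces of \<open>\<alpha>\<close> have disappeared, and what remains is
  the classical Poincare lemma for polynomial forms: the anticommutator of \<open>d\<close> and the Euler
  contraction is the Lie derivative along the Euler field, which multiplies a term of polynomial
  degree \<open>|m|\<close> and form degree \<open>p\<close> by \<open>|m| + p\<close>. As \<open>d\<close> preserves this weight, dividing by it turns
  the anticommutator into the identity wherever the weight is nonzero, that is, everywhere except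
  on constant \<open>0\<close>-forms.

  The argument is carried out on coefficients rather than by linear extension from basis forms.
  A form is determined by its array of normalized coefficients (\<open>forms_eqI\<close>); the differential and
  the homotopy act on such arrays by the explicit formulas \<open>koszul_d\<close> and \<open>koszul_h\<close>
  (\<open>ncoef_frac_d\<close>, \<open>ncoef_homotopy\<close>); and the homotopy identity is a pointwise identity between
  arrays (\<open>koszul_homotopy\<close>), in which the diagonal terms add up to the weight and the
  off-diagonal terms cancel because the two ways of removing \<open>i\<close> from \<open>J\<close> and adding \<open>k\<close> to it
  have opposite signs (\<open>insert_sign_exchange\<close>).

  Reading off coefficients requires that the monomials be linearly independent as functions on the
  box (\<open>monom_independent\<close>). Halving the \<open>i\<close>-th coordinate maps the box to itself and multiplies the
  monomial with exponents \<open>m\<close> by \<open>(2\<^sup>-\<^sup>\<alpha>)\<^sup>m\<^sup>i\<close>; thus the monomials are simultaneous eigenfunctions of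
  these substitutions, and distinct monomials are separated by at least one eigenvalue.

  The cohomology follows from the homotopy formula. A closed form \<open>\<omega>\<close> of positive degree is
  killed by the projection, so \<open>\<omega> = d K \<omega>\<close>; a closed \<open>0\<close>-form is killed by \<open>K\<close>, so it equals its
  projection and is constant.
\<close>

section \<open>The Koszul homotopy on coefficient arrays\<close>

text \<open>
  The sign that appears when \<open>dX\<^sub>i\<close> is moved from the front of the product to its place in the
  increasing tuple \<open>J\<close>. It does not depend on whether \<open>i\<close> itself belongs to \<open>J\<close>, so the same
  function serves for insertion and for removal of \<open>i\<close>.
\<close>

definition insert_sign :: "'n::linorder \<Rightarrow> 'n set \<Rightarrow> real" where
  "insert_sign i J = (- 1) ^ card {j \<in> J. j < i}"

text \<open>
  The exterior derivative and the weighted Euler contraction of polynomial forms, written for the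
  array \<open>a J m\<close> of coefficients of \<open>x\<^sup>m dx\<^sub>J\<close>. Each formula collects the terms that arrive at
  position \<open>(J, m)\<close>, hence the shifts opposite to the action on basis elements. In \<open>koszul_h\<close> the
  source has polynomial degree \<open>|m| - 1\<close> and form degree \<open>|J| + 1\<close>, so its weight is \<open>|m| + |J|\<close>.
\<close>

definition koszul_d ::
    "('n::{finite,linorder} set \<Rightarrow> ('n \<Rightarrow> nat) \<Rightarrow> real) \<Rightarrow> 'n set \<Rightarrow> ('n \<Rightarrow> nat) \<Rightarrow> real" where
  "koszul_d a J m =
     (\<Sum>i\<in>J. insert_sign i J * real (m i + 1) * a (J - {i}) (m(i := m i + 1)))"

definition koszul_h ::
    "('n::{finite,linorder} set \<Rightarrow> ('n \<Rightarrow> nat) \<Rightarrow> real) \<Rightarrow> 'n set \<Rightarrow> ('n \<Rightarrow> nat) \<Rightarrow> real" where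
  "koszul_h a J m =
     (\<Sum>i | i \<notin> J \<and> 0 < m i. insert_sign i J * a (insert i J) (m(i := m i - 1)))
       / real (sum m UNIV + card J)"

lemma insert_sign_remove [simp]: "insert_sign i (J - {i}) = insert_sign i J"
  unfolding insert_sign_def by (rule arg_cong[where f = "\<lambda>A. (- 1) ^ card A"]) auto

lemma insert_sign_insert [simp]: "insert_sign i (insert i J) = insert_sign i J"
  unfolding insert_sign_def by (rule arg_cong[where f = "\<lambda>A. (- 1) ^ card A"]) auto

lemma insert_sign_square [simp]: "insert_sign i J * insert_sign i J = 1"
  by (simp add: insert_sign_def flip: power_mult_distrib)

lemma insert_sign_cancel [simp]: "insert_sign i J * (insert_sign i J * x) = x"
  by (simp flip: mult.assoc)

text \<open>
  Anticommutativity of removing \<open>i\<close> and inserting \<open>k\<close>: if \<open>i < k\<close>, the sign of \<open>k\<close> changes when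
  \<open>i\<close> is removed from the set while that of \<open>i\<close> is unaffected by the presence of \<open>k\<close>; if \<open>k < i\<close>,
  the roles are exchanged.
\<close>

lemma insert_sign_exchange:
  fixes i k :: "'n::{finite,linorder}"
  assumes "i \<in> J" "k \<notin> J"
  shows "insert_sign i J * insert_sign k (J - {i}) = - (insert_sign k J * insert_sign i (insert k J))"
proof (cases "i < k")
  case True
  have "{j \<in> J. j < k} = insert i {j \<in> J - {i}. j < k}" using True assms by auto
  then have "card {j \<in> J. j < k} = Suc (card {j \<in> J - {i}. j < k})" by simp
  moreover have "{j \<in> insert k J. j < i} = {j \<in> J. j < i}" using True by auto
  ultimately show ?thesis by (simp add: insert_sign_def)
next
  case False
  with assms have ki: "k < i" by (metis linorder_neqE)
  have "{j \<in> insert k J. j < i} = insert k {j \<in> J. j < i}" using ki by auto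
  then have "card {j \<in> insert k J. j < i} = Suc (card {j \<in> J. j < i})" using assms by simp
  moreover have "{j \<in> J - {i}. j < k} = {j \<in> J. j < k}" using ki by auto
  ultimately show ?thesis by (simp add: insert_sign_def)
qed

lemma sum_multiindex_upd: "sum (m(i := x)) (UNIV :: 'n::finite set) + m i = sum m UNIV + (x :: nat)"
  by (simp add: sum.remove[of UNIV i] sum.remove[of UNIV i m])

text \<open>
  Both composites move one index out of \<open>J\<close> and one into it. When the two indices agree, the
  contribution is \<open>m\<^sub>i + 1\<close> for \<open>i \<in> J\<close> (from \<open>koszul_d (koszul_h a)\<close>) and \<open>m\<^sub>k\<close> for \<open>k \<notin> J\<close> (from the
  other composite), with total \<open>|m| + |J|\<close>, the common denominator. When they differ, the
  contributions \<open>cross i k\<close> of the two composites cancel.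
\<close>

lemma koszul_homotopy:
  fixes a :: "'n::{finite,linorder} set \<Rightarrow> ('n \<Rightarrow> nat) \<Rightarrow> real"
  assumes pos: "0 < sum m UNIV + card J"
  shows "koszul_d (koszul_h a) J m + koszul_h (koszul_d a) J m = a J m"
proof -
  define N where "N = sum m UNIV + card J"
  define Q where "Q = {k. k \<notin> J \<and> 0 < m k}"
  define b where "b i k = a (insert k (J - {i})) (m(i := m i + 1, k := m k - 1))" for i k
  define cross where
    "cross i k = insert_sign i J * insert_sign k (J - {i}) * real (m i + 1) * b i k" for i k
  have N: "real N \<noteq> 0" using pos unfolding of_nat_eq_0_iff N_def by linarith
  have dh: "koszul_d (koszul_h a) J m
      = (\<Sum>i\<in>J. real (m i + 1) * a J m + (\<Sum>k\<in>Q. cross i k)) / real N"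
  proof -
    have "insert_sign i J * real (m i + 1) * koszul_h a (J - {i}) (m(i := m i + 1))
        = (real (m i + 1) * a J m + (\<Sum>k\<in>Q. cross i k)) / real N" if i: "i \<in> J" for i
    proof -
      let ?m = "m(i := m i + 1)"
      let ?s = "\<lambda>k. insert_sign k (J - {i}) * a (insert k (J - {i})) (?m(k := ?m k - 1))"
      have "0 < card J" using i by (auto simp: card_gt_0_iff)
      then have deg: "sum ?m UNIV + card (J - {i}) = N"
        using sum_multiindex_upd[of m i "m i + 1"] i by (simp add: N_def)
      \<comment> \<open>Removing \<open>i\<close> makes room for reinserting \<open>i\<close> itself: this is the diagonal term.\<close>
      have idx: "{k. k \<notin> J - {i} \<and> 0 < ?m k} = insert i Q"
        using i by (auto simp: Q_def)
      have iQ: "i \<notin> Q" using i by (simp add: Q_def)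
      have "(\<Sum>k\<in>insert i Q. ?s k) = insert_sign i J * a J m + (\<Sum>k\<in>Q. insert_sign k (J - {i}) * b i k)"
      proof -
        have "?s i = insert_sign i J * a J m" using i by (simp add: insert_absorb)
        moreover have "(\<Sum>k\<in>Q. ?s k) = (\<Sum>k\<in>Q. insert_sign k (J - {i}) * b i k)"
          using iQ by (intro sum.cong) (auto simp: b_def)
        ultimately show ?thesis using iQ by simp
      qed
      then have "koszul_h a (J - {i}) ?m
          = (insert_sign i J * a J m + (\<Sum>k\<in>Q. insert_sign k (J - {i}) * b i k)) / real N"
        unfolding koszul_h_def idx deg by simp
      then have "insert_sign i J * real (m i + 1) * koszul_h a (J - {i}) ?m
          = ((insert_sign i J * insert_sign i J) * real (m i + 1) * a J m
             + insert_sign i J * real (m i + 1) * (\<Sum>k\<in>Q. insert_sign k (J - {i}) * b i k)) / real N"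
        by (simp add: algebra_simps)
      also have "insert_sign i J * real (m i + 1) * (\<Sum>k\<in>Q. insert_sign k (J - {i}) * b i k)
          = (\<Sum>k\<in>Q. cross i k)"
        by (simp add: cross_def sum_distrib_left mult_ac)
      finally show ?thesis by (simp only: insert_sign_square mult_1_left)
    qed
    then show ?thesis unfolding koszul_d_def sum_divide_distrib by (intro sum.cong) auto
  qed
  have hd: "koszul_h (koszul_d a) J m
      = (\<Sum>k\<in>Q. real (m k) * a J m - (\<Sum>i\<in>J. cross i k)) / real N"
  proof -
    have "insert_sign k J * koszul_d a (insert k J) (m(k := m k - 1))
        = real (m k) * a J m - (\<Sum>i\<in>J. cross i k)" if k: "k \<in> Q" for k
    proof -
      let ?m = "m(k := m k - 1)"
      let ?t = "\<lambda>i. insert_sign i (insert k J) * real (?m i + 1)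
                  * a (insert k J - {i}) (?m(i := ?m i + 1))"
      have kJ: "k \<notin> J" "0 < m k" using k by (auto simp: Q_def)
      have "koszul_d a (insert k J) ?m = ?t k + (\<Sum>i\<in>J. ?t i)"
        unfolding koszul_d_def using kJ by (simp del: fun_upd_apply)
      moreover have "?t k = insert_sign k J * real (m k) * a J m"
        using kJ by simp
      moreover have "insert_sign k J * (\<Sum>i\<in>J. ?t i) = - (\<Sum>i\<in>J. cross i k)"
        unfolding sum_distrib_left sum_negf[symmetric]
      proof (rule sum.cong[OF refl])
        fix i assume i: "i \<in> J"
        have ik: "i \<noteq> k" using i kJ by auto
        have "insert k J - {i} = insert k (J - {i})" using ik by auto
        then have "insert_sign k J * ?t i
            = (insert_sign k J * insert_sign i (insert k J)) * real (m i + 1) * b i k"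
          using ik by (simp add: b_def fun_upd_twist)
        then show "insert_sign k J * ?t i = - cross i k"
          using insert_sign_exchange[OF i kJ(1)] by (simp add: cross_def)
      qed
      ultimately show ?thesis
        by (simp add: distrib_left mult.assoc[symmetric] del: fun_upd_apply)
    qed
    then show ?thesis unfolding koszul_h_def Q_def[symmetric] N_def[symmetric] by simp
  qed
  have "koszul_d (koszul_h a) J m + koszul_h (koszul_d a) J m
      = (\<Sum>i\<in>J. real (m i + 1) * a J m) / real N + (\<Sum>k\<in>Q. real (m k) * a J m) / real N"
    using sum.swap[of cross Q J]
    by (simp add: dh hd sum.distrib sum_subtractf add_divide_distrib diff_divide_distrib)
  also have "\<dots> = real ((\<Sum>i\<in>J. m i + 1) + (\<Sum>k\<in>Q. m k)) * a J m / real N"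
    by (simp add: sum_distrib_right distrib_right add_divide_distrib)
  also have "(\<Sum>i\<in>J. m i + 1) + (\<Sum>k\<in>Q. m k) = N"
  proof -
    have "(\<Sum>k\<in>Q. m k) = (\<Sum>k\<in>- J. m k)"
      by (intro sum.mono_neutral_left) (auto simp: Q_def)
    moreover have "sum m J + sum m (- J) = sum m UNIV"
      by (metis Compl_partition Compl_disjoint finite sum.union_disjoint)
    ultimately show ?thesis unfolding N_def sum.distrib by simp
  qed
  finally show ?thesis using N by simp
qed

section \<open>Linear independence of the fractional monomials\<close>

text \<open>
  Any factor in \<open>(0, 1)\<close> would serve: the substitution must preserve every box \<open>[0, b]\<close> and have
  distinct eigenvalues on distinct powers of one coordinate.
\<close>

definition halve :: "'n::finite \<Rightarrow> real^'n \<Rightarrow> real^'n" where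
  "halve i x = (\<chi> j. if j = i then x $ j / 2 else x $ j)"

locale frac_box =
  fixes \<alpha> :: real and b :: "real^'n::{finite,linorder}" and U :: "(real^'n::{finite,linorder}) set"
  assumes alpha_pos: "0 < \<alpha>"
    and b_pos: "\<And>i. 0 < b $ i"
    and U_box: "U = cbox 0 b"
begin

abbreviation "fmonom \<equiv> frac_monom \<alpha> U"
abbreviation "coef \<equiv> frac_coeff \<alpha> U"
abbreviation "fpoly \<equiv> frac_poly \<alpha> U"

lemma in_U: "x \<in> U \<longleftrightarrow> (\<forall>i. 0 \<le> x $ i \<and> x $ i \<le> b $ i)"
  by (simp add: U_box mem_box_cart)

lemma b_in_U: "b \<in> U"
  using b_pos by (auto simp: in_U less_imp_le)

lemma Gamma_affine_pos: "0 < Gamma (real k * \<alpha> + 1)"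
  using alpha_pos by (intro Gamma_real_pos) (simp add: add_nonneg_pos)

lemma Gamma_one_plus_pos: "0 < Gamma (1 + \<alpha>)"
  using alpha_pos by (intro Gamma_real_pos) simp

text \<open>
  The corner \<open>b\<close> has no vanishing coordinate, so a scalar multiple of a single monomial is zero
  only if the scalar is.
\<close>

lemma monom_b_nonzero: "fmonom m b \<noteq> 0"
  using b_in_U Gamma_one_plus_pos b_pos
  by (auto simp: frac_monom_def frac_coord_def less_imp_neq[symmetric])

lemma halve_in_U:
  assumes "x \<in> U"
  shows "halve i x \<in> U"
proof -
  have "0 \<le> x $ j" "x $ j \<le> b $ j" for j using assms by (auto simp: in_U)
  then have "0 \<le> x $ j / 2 \<and> x $ j / 2 \<le> b $ j" "0 \<le> x $ j \<and> x $ j \<le> b $ j" for j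
    by (smt (verit) field_sum_of_halves)+
  then show ?thesis by (simp add: in_U halve_def)
qed

lemma monom_halve:
  assumes "x \<in> U"
  shows "fmonom m (halve i x) = ((1/2) powr \<alpha>) ^ m i * fmonom m x"
proof -
  have "frac_coord \<alpha> U j (halve i x)
      = (if j = i then (1/2) powr \<alpha> else 1) * frac_coord \<alpha> U j x" for j
    using assms halve_in_U[OF assms, of i]
    by (auto simp: frac_coord_def halve_def in_U powr_divide powr_one_eq_one)
  then have "(\<Prod>j\<in>UNIV. frac_coord \<alpha> U j (halve i x) ^ m j)
      = (\<Prod>j\<in>UNIV. (if j = i then ((1/2) powr \<alpha>) ^ m i else 1) * frac_coord \<alpha> U j x ^ m j)"
    by (intro prod.cong) (auto simp: power_mult_distrib)
  then show ?thesis
    using assms halve_in_U[OF assms, of i]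
    by (simp add: frac_monom_def prod.distrib)
qed

lemma half_powr_power_inj: "((1/2) powr \<alpha>) ^ k = ((1/2) powr \<alpha>) ^ l \<longleftrightarrow> k = l"
proof -
  have "(1/2 :: real) powr \<alpha> < 1" using alpha_pos powr_less_mono2[of \<alpha> "1/2" 1] by simp
  moreover have "0 < (1/2 :: real) powr \<alpha>" by simp
  ultimately show ?thesis by (metis power_strict_decreasing_iff nat_neq_iff less_irrefl)
qed

text \<open>
  The usual proof that eigenvectors with distinct eigenvalues are independent: to isolate the
  coefficient of \<open>m1\<close> from that of \<open>m0\<close>, choose a coordinate \<open>i\<close> in which the exponents differ and
  subtract the eigenvalue of \<open>m0\<close> times the relation from its image under \<open>halve i\<close>. This removes
  \<open>m0\<close> and multiplies the coefficient of \<open>m1\<close> by a nonzero number.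
\<close>

lemma monom_independent:
  assumes "finite S" "\<And>x. x \<in> U \<Longrightarrow> (\<Sum>m\<in>S. c m * fmonom m x) = 0" "m \<in> S"
  shows "c m = 0"
  using assms
proof (induction S arbitrary: c m rule: finite_induct)
  case (insert m0 S)
  let ?q = "(1/2 :: real) powr \<alpha>"
  have S0: "c m1 = 0" if m1: "m1 \<in> S" for m1
  proof -
    have "m1 \<noteq> m0" using m1 insert.hyps by auto
    then obtain i where i: "m1 i \<noteq> m0 i" by auto
    have "(\<Sum>m\<in>S. c m * (?q ^ m i - ?q ^ m0 i) * fmonom m x) = 0" if x: "x \<in> U" for x
    proof -
      have "(\<Sum>m\<in>insert m0 S. c m * fmonom m (halve i x))
          - ?q ^ m0 i * (\<Sum>m\<in>insert m0 S. c m * fmonom m x) = 0"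
        using insert.prems(1)[OF x] insert.prems(1)[OF halve_in_U[OF x, of i]] by simp
      moreover have "(\<Sum>m\<in>insert m0 S. c m * fmonom m (halve i x))
          - ?q ^ m0 i * (\<Sum>m\<in>insert m0 S. c m * fmonom m x)
          = (\<Sum>m\<in>insert m0 S. c m * (?q ^ m i - ?q ^ m0 i) * fmonom m x)"
        unfolding sum_distrib_left sum_subtractf[symmetric]
        by (intro sum.cong refl) (simp add: monom_halve[OF x] algebra_simps)
      ultimately show ?thesis using insert.hyps by simp
    qed
    from insert.IH[OF this m1] i show ?thesis by (simp add: half_powr_power_inj)
  qed
  have "c m0 * fmonom m0 b = 0"
    using insert.prems(1)[OF b_in_U] S0 insert.hyps by simp
  then have "c m0 = 0" using monom_b_nonzero by simp
  with S0 insert.prems(2) show ?case by auto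
qed simp

section \<open>Expansion coefficients\<close>

text \<open>
  The body of the definite description that defines \<open>frac_coeff\<close>. As a relation between functions
  and coefficient families it can be established term by term; by uniqueness it then evaluates
  \<open>frac_coeff\<close> (\<open>expansion_coef\<close>).
\<close>

definition expansion where
  "expansion f c \<longleftrightarrow> finite {m. c m \<noteq> 0} \<and> f = (\<lambda>x. \<Sum>m | c m \<noteq> 0. c m * fmonom m x)"

lemma expansionI:
  assumes "finite S" "\<And>m. m \<notin> S \<Longrightarrow> c m = 0" "\<And>x. f x = (\<Sum>m\<in>S. c m * fmonom m x)"
  shows "expansion f c"
proof -
  have sub: "{m. c m \<noteq> 0} \<subseteq> S" using assms(2) by auto
  have "(\<Sum>m\<in>S. c m * fmonom m x) = (\<Sum>m | c m \<noteq> 0. c m * fmonom m x)" for x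
    using assms(1) sub by (intro sum.mono_neutral_right) auto
  then show ?thesis
    using finite_subset[OF sub assms(1)] assms(3) by (auto simp: expansion_def)
qed

lemma expansion_superset:
  assumes "expansion f c" "finite S" "{m. c m \<noteq> 0} \<subseteq> S"
  shows "f x = (\<Sum>m\<in>S. c m * fmonom m x)"
proof -
  have "f x = (\<Sum>m | c m \<noteq> 0. c m * fmonom m x)" using assms(1) by (simp add: expansion_def)
  also have "\<dots> = (\<Sum>m\<in>S. c m * fmonom m x)"
    using assms(2,3) by (intro sum.mono_neutral_left) auto
  finally show ?thesis .
qed

lemma expansion_unique:
  assumes "expansion f c" "expansion f c'"
  shows "c = c'"
proof
  fix m
  let ?S = "{m. c m \<noteq> 0} \<union> {m. c' m \<noteq> 0}"
  have fin: "finite ?S" using assms by (simp add: expansion_def)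
  have "(\<Sum>m\<in>?S. (c m - c' m) * fmonom m x) = 0" for x
    using expansion_superset[OF assms(1) fin, of x] expansion_superset[OF assms(2) fin, of x]
    by (simp add: left_diff_distrib sum_subtractf)
  then have "c m - c' m = 0" if "m \<in> ?S"
    using monom_independent[OF fin, of "\<lambda>m. c m - c' m"] that by blast
  then show "c m = c' m" by (cases "m \<in> ?S") auto
qed

lemma expansion_coef:
  assumes "expansion f c"
  shows "coef f = c"
proof -
  have "coef f = (THE c. expansion f c)" by (simp add: frac_coeff_def expansion_def)
  also have "\<dots> = c" using assms by (intro the_equality) (auto intro: expansion_unique)
  finally show ?thesis .
qed

lemma expansion_add:
  assumes "expansion f c" "expansion g c'"
  shows "expansion (f + g) (\<lambda>m. c m + c' m)"
proof -
  let ?S = "{m. c m \<noteq> 0} \<union> {m. c' m \<noteq> 0}"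
  have fin: "finite ?S" using assms by (simp add: expansion_def)
  show ?thesis
    using expansion_superset[OF assms(1) fin] expansion_superset[OF assms(2) fin]
    by (intro expansionI[OF fin]) (auto simp: distrib_right sum.distrib)
qed

lemma expansion_scale: "expansion f c \<Longrightarrow> expansion (\<lambda>x. a * f x) (\<lambda>m. a * c m)"
  by (rule expansionI[of "{m. c m \<noteq> 0}"]) (auto simp: expansion_def sum_distrib_left mult.assoc)

lemma expansion_zero: "expansion 0 (\<lambda>m. 0)"
  by (simp add: expansion_def fun_eq_iff)

text \<open>
  The expansions of all operators below are obtained from this lemma, since each operator is
  defined as a finite sum of scaled monomials.
\<close>

lemma expansion_lincomb:
  assumes "\<And>k. k \<in> A \<Longrightarrow> expansion (f k) (c k)"
  shows "expansion (\<lambda>x. \<Sum>k\<in>A. a k * f k x) (\<lambda>m. \<Sum>k\<in>A. a k * c k m)"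
  using assms
proof (induction A rule: infinite_finite_induct)
  case (insert k A)
  then have "expansion ((\<lambda>x. a k * f k x) + (\<lambda>x. \<Sum>k\<in>A. a k * f k x))
      (\<lambda>m. a k * c k m + (\<Sum>k\<in>A. a k * c k m))"
    by (intro expansion_add expansion_scale) auto
  with insert.hyps show ?case by (simp add: plus_fun_def)
qed (use expansion_zero in \<open>simp_all add: zero_fun_def\<close>)

lemma expansion_monom: "expansion (fmonom m) (\<lambda>m'. if m' = m then 1 else 0)"
  by (rule expansionI[of "{m}"]) auto

lemma expansion_const: "expansion (fconst U a) (\<lambda>m. if m = (\<lambda>_. 0) then a else 0)"
  by (rule expansionI[of "{\<lambda>_. 0}"]) (auto simp: fconst_def frac_monom_def)

lemma expansion_coord: "\<exists>c. expansion (frac_coord \<alpha> U i) c"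
proof -
  have "fmonom (\<lambda>j. if j = i then 1 else 0) = frac_coord \<alpha> U i"
    by (auto simp: frac_monom_def fun_eq_iff frac_coord_def if_distrib[of "power _"] cong: if_cong)
  then show ?thesis using expansion_monom by metis
qed

lemma monom_mult: "fmonom m x * fmonom m' x = fmonom (\<lambda>i. m i + m' i) x"
  by (simp add: frac_monom_def power_add prod.distrib)

lemma expansion_mult:
  assumes "expansion f c" "expansion g c'"
  shows "\<exists>c. expansion (f * g) c"
proof -
  let ?A = "{m. c m \<noteq> 0} \<times> {m. c' m \<noteq> 0}"
  have eq: "f * g = (\<lambda>x. \<Sum>k\<in>?A. (c (fst k) * c' (snd k)) * fmonom (\<lambda>i. fst k i + snd k i) x)"
    using assms
    by (simp add: expansion_def fun_eq_iff sum_product sum.cartesian_product monom_mult[symmetric]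
          split_def mult_ac)
  have "expansion (f * g) (\<lambda>m. \<Sum>k\<in>?A. (c (fst k) * c' (snd k)) *
      (if m = (\<lambda>i. fst k i + snd k i) then 1 else 0))"
    unfolding eq by (intro expansion_lincomb expansion_monom)
  then show ?thesis by blast
qed

lemma expansion_poly:
  assumes "f \<in> fpoly"
  shows "expansion f (coef f)"
proof -
  from assms have "\<exists>c. expansion f c"
  proof induction
    case (const c)
    show ?case using expansion_const by blast
  next
    case (coord i)
    show ?case by (rule expansion_coord)
  next
    case (add f g)
    then show ?case using expansion_add by blast
  next
    case (mult f g)
    then show ?case using expansion_mult by blast
  qed
  then show ?thesis using expansion_coef by metis
qed

lemma sum_in_poly:
  "(\<And>k. k \<in> A \<Longrightarrow> f k \<in> fpoly) \<Longrightarrow> (\<lambda>x. \<Sum>k\<in>A. f k x) \<in> fpoly"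
proof (induction A rule: infinite_finite_induct)
  case (insert k A)
  then have "f k + (\<lambda>x. \<Sum>k\<in>A. f k x) \<in> fpoly" by (intro frac_poly.add) auto
  with insert.hyps show ?case by (simp add: plus_fun_def)
qed (use frac_poly.const[of U 0 \<alpha>] in \<open>simp_all add: fconst_def\<close>)

lemma scale_in_poly: "f \<in> fpoly \<Longrightarrow> (\<lambda>x. a * f x) \<in> fpoly"
proof -
  assume f: "f \<in> fpoly"
  from f have "f x = 0" if "x \<notin> U" for x
    using that by induction (auto simp: fconst_def frac_coord_def)
  then have "(\<lambda>x. a * f x) = fconst U a * f" by (auto simp: fconst_def)
  with f show ?thesis by (simp add: frac_poly.const frac_poly.mult)
qed

lemma monom_in_poly: "fmonom m \<in> fpoly"
proof -
  have pow: "(\<lambda>x. fconst U 1 x * frac_coord \<alpha> U i x ^ k) \<in> fpoly" for i k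
  proof (induction k)
    case 0
    show ?case using frac_poly.const[of U 1] by simp
  next
    case (Suc k)
    have "(\<lambda>x. fconst U 1 x * frac_coord \<alpha> U i x ^ Suc k)
        = frac_coord \<alpha> U i * (\<lambda>x. fconst U 1 x * frac_coord \<alpha> U i x ^ k)" by auto
    then show ?case using frac_poly.mult[OF frac_poly.coord Suc] by simp
  qed
  have "(\<lambda>x. fconst U 1 x * (\<Prod>i\<in>A. frac_coord \<alpha> U i x ^ m i)) \<in> fpoly" for A
  proof (induction A rule: infinite_finite_induct)
    case (insert i A)
    have "(\<lambda>x. fconst U 1 x * (\<Prod>i\<in>insert i A. frac_coord \<alpha> U i x ^ m i))
        = (\<lambda>x. fconst U 1 x * frac_coord \<alpha> U i x ^ m i)
          * (\<lambda>x. fconst U 1 x * (\<Prod>i\<in>A. frac_coord \<alpha> U i x ^ m i))"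
      using insert.hyps by (auto simp: fconst_def)
    then show ?case using frac_poly.mult[OF pow insert.IH] by simp
  qed (use frac_poly.const[of U 1] in simp_all)
  from this[of UNIV] show ?thesis
    by (simp add: frac_monom_def fconst_def if_distrib[of "\<lambda>c. c * _"] cong: if_cong)
qed

lemma expansion_in_poly: "expansion f c \<Longrightarrow> f \<in> fpoly"
  by (auto simp: expansion_def intro!: sum_in_poly scale_in_poly monom_in_poly)

text \<open>
  With this lemma, identities between forms become identities between real numbers.
\<close>

lemma poly_eqI:
  assumes "f \<in> fpoly" "g \<in> fpoly" "\<And>m. coef f m = coef g m"
  shows "f = g"
proof -
  have "coef f = coef g" using assms(3) by auto
  then show ?thesis
    using expansion_poly[OF assms(1)] expansion_poly[OF assms(2)] by (simp add: expansion_def)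
qed

section \<open>The operators in coordinates\<close>

lemma sum_fun_apply: "(\<Sum>i\<in>A. f i) x = (\<Sum>i\<in>A. f i x)"
  by (induction A rule: infinite_finite_induct) auto

text \<open>
  The operator lowers the \<open>i\<close>-th exponent, so the coefficient at \<open>m\<close> comes from the single monomial
  with \<open>i\<close>-th exponent \<open>m\<^sub>i + 1\<close>; monomials free of \<open>X\<^sub>i\<close> contribute nothing.
\<close>

lemma expansion_caputo:
  assumes "f \<in> fpoly"
  shows "expansion (caputo \<alpha> U i f) (\<lambda>m. Gamma (real (m i + 1) * \<alpha> + 1) /
     (Gamma (real (m i) * \<alpha> + 1) * Gamma (1 + \<alpha>)) * coef f (m(i := m i + 1)))"
proof -
  let ?g = "\<lambda>k. Gamma (real k * \<alpha> + 1) / (Gamma ((real k - 1) * \<alpha> + 1) * Gamma (1 + \<alpha>))"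
  let ?c = "\<lambda>m m'. if 0 < m i then ?g (m i) * (if m' = m(i := m i - 1) then 1 else 0) else 0"
  let ?S = "{m. coef f m \<noteq> 0}"
  have fin: "finite ?S" using expansion_poly[OF assms] by (simp add: expansion_def)
  have "expansion (caputo_monom \<alpha> U i m) (?c m)" for m
  proof (cases "0 < m i")
    case True
    then have "caputo_monom \<alpha> U i m = (\<lambda>x. ?g (m i) * fmonom (m(i := m i - 1)) x)"
      "?c m = (\<lambda>m'. ?g (m i) * (if m' = m(i := m i - 1) then 1 else 0))"
      by (simp_all add: caputo_monom_def)
    then show ?thesis by (simp only: expansion_scale expansion_monom)
  qed (use expansion_zero in \<open>simp add: caputo_monom_def\<close>)
  then have "expansion (caputo \<alpha> U i f) (\<lambda>m'. \<Sum>m\<in>?S. coef f m * ?c m m')"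
    unfolding caputo_def by (rule expansion_lincomb)
  moreover have "(\<Sum>m\<in>?S. coef f m * ?c m m') = ?g (m' i + 1) * coef f (m'(i := m' i + 1))" for m'
  proof -
    let ?u = "m'(i := m' i + 1)"
    have iff: "0 < m i \<and> m' = m(i := m i - 1) \<longleftrightarrow> m = ?u" for m
      by (auto simp: fun_eq_iff)
    have "coef f m * ?c m m' = (if m = ?u then coef f ?u * ?g (m' i + 1) else 0)" for m
    proof (cases "m = ?u")
      case False
      then have "?c m m' = 0" using iff[of m] by auto
      with False show ?thesis by simp
    qed simp
    then show ?thesis using fin by simp
  qed
  ultimately show ?thesis by simp
qed


lemma wedge_dX_single:
  "wedge (dX U {i}) (dX U I) J x
     = (if i \<in> J \<and> I = J - {i} then insert_sign i J * fconst U 1 x else 0)"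
proof -
  have "{(k, j). k \<in> {i} \<and> j \<in> I \<and> j < k} = Pair i ` {j \<in> I. j < i}" by auto
  then have "card {(k, j). k \<in> {i} \<and> j \<in> I \<and> j < k} = card {j \<in> I. j < i}"
    by (simp add: card_image inj_on_def)
  then have "wedge (dX U {i}) (dX U I)
      = (if i \<notin> I then form_scale (insert_sign i I) (dX U (insert i I)) else 0)"
    unfolding wedge_dX by (simp add: insert_sign_def)
  moreover have "i \<in> J \<and> I = J - {i} \<longleftrightarrow> i \<notin> I \<and> J = insert i I" by auto
  ultimately show ?thesis by (auto simp: form_scale_def dX_def form_term_def)
qed

lemma caputo_outside: "x \<notin> U \<Longrightarrow> caputo \<alpha> U i f x = 0"
  unfolding caputo_def by (intro sum.neutral) (simp add: caputo_monom_def frac_monom_def)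

text \<open>
  The basis element \<open>dX\<^sub>J\<close> arises from \<open>dX\<^sub>i \<and> dX\<^sub>I\<close> exactly when \<open>i \<in> J\<close> and \<open>I = J - {i}\<close>.
\<close>

lemma frac_d_apply:
  "frac_d \<alpha> U \<omega> J = (\<lambda>x. \<Sum>i\<in>J. insert_sign i J * caputo \<alpha> U i (\<omega> (J - {i})) x)"
proof
  fix x
  have c: "caputo \<alpha> U i f x * (insert_sign i J * fconst U 1 x) = insert_sign i J * caputo \<alpha> U i f x"
    for i f by (simp add: fconst_def caputo_outside)
  have "frac_d \<alpha> U \<omega> J x = (\<Sum>i\<in>UNIV. \<Sum>I\<in>UNIV. if I = J - {i} then
      (if i \<in> J then insert_sign i J * caputo \<alpha> U i (\<omega> I) x else 0) else 0)"
    unfolding frac_d_def sum_fun_apply form_mult_def times_fun_apply wedge_dX_single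
    by (subst sum.swap) (intro sum.cong refl, auto simp: c)
  also have "\<dots> = (\<Sum>i\<in>J. insert_sign i J * caputo \<alpha> U i (\<omega> (J - {i})) x)"
    by (simp add: sum.inter_restrict[symmetric])
  finally show "frac_d \<alpha> U \<omega> J x = (\<Sum>i\<in>J. insert_sign i J * caputo \<alpha> U i (\<omega> (J - {i})) x)" .
qed

lemma phi_pos: "0 < phi \<alpha> k"
  using Gamma_affine_pos Gamma_one_plus_pos by (simp add: phi_def)

text \<open>
  The reason for the choice of \<open>\<phi>\<close>: up to the ratio of the normalizing factors, the Caputo
  coefficient is that of the ordinary derivative.
\<close>

lemma caputo_factor_phi:
  "Gamma (real (k + 1) * \<alpha> + 1) / (Gamma (real k * \<alpha> + 1) * Gamma (1 + \<alpha>))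
     = real (k + 1) * phi \<alpha> (k + 1) / phi \<alpha> k"
proof -
  have "Gamma (real k * \<alpha> + 1) \<noteq> 0" "Gamma (1 + \<alpha>) \<noteq> 0"
    using Gamma_affine_pos[of k] Gamma_one_plus_pos by simp_all
  then show ?thesis unfolding phi_def fact_Suc Suc_eq_plus1[symmetric] power_Suc of_nat_mult
    by (simp add: divide_simps del: of_nat_Suc)
qed

lemma phi_multi_pos: "0 < phi_multi \<alpha> m"
  by (simp add: phi_multi_def prod_pos phi_pos)

lemma phi_multi_upd: "phi_multi \<alpha> (m(i := k)) * phi \<alpha> (m i) = phi_multi \<alpha> m * phi \<alpha> k"
proof -
  have "(\<Prod>j\<in>UNIV - {i}. phi \<alpha> ((m(i := k)) j)) = (\<Prod>j\<in>UNIV - {i}. phi \<alpha> (m j))"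
    by (intro prod.cong) auto
  then show ?thesis by (simp add: phi_multi_def prod.remove[of UNIV i])
qed

text \<open>
  The coefficient with respect to the rescaled monomials \<open>(X\<^sup>\<alpha>)\<^sup>m / \<phi>(m)\<close>.
\<close>

definition ncoef where
  "ncoef \<omega> (J :: 'n set) m = phi_multi \<alpha> m * coef (\<omega> J) m"

lemma forms_expansion: "\<omega> \<in> forms \<alpha> U \<Longrightarrow> expansion (\<omega> J) (coef (\<omega> J))"
  by (simp add: forms_def expansion_poly)

lemma forms_eqI:
  assumes "\<omega> \<in> forms \<alpha> U" "\<eta> \<in> forms \<alpha> U" "\<And>J m. ncoef \<omega> J m = ncoef \<eta> J m"
  shows "\<omega> = \<eta>"
proof
  fix J
  have "coef (\<omega> J) m = coef (\<eta> J) m" for m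
    using assms(3)[of J m] phi_multi_pos[of m] by (simp add: ncoef_def)
  then show "\<omega> J = \<eta> J" using assms(1,2) by (intro poly_eqI) (auto simp: forms_def)
qed

lemma expansion_frac_d:
  assumes "\<omega> \<in> forms \<alpha> U"
  shows "expansion (frac_d \<alpha> U \<omega> J) (\<lambda>m. \<Sum>i\<in>J. insert_sign i J *
     (real (m i + 1) * phi \<alpha> (m i + 1) / phi \<alpha> (m i) * coef (\<omega> (J - {i})) (m(i := m i + 1))))"
  unfolding frac_d_apply caputo_factor_phi[symmetric]
  using assms by (intro expansion_lincomb expansion_caputo) (simp add: forms_def)

lemma frac_d_in_forms:
  assumes "\<omega> \<in> forms \<alpha> U"
  shows "frac_d \<alpha> U \<omega> \<in> forms \<alpha> U"
proof -
  have "frac_d \<alpha> U \<omega> J \<in> fpoly" for J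
    by (rule expansion_in_poly[OF expansion_frac_d[OF assms]])
  then show ?thesis by (simp add: forms_def)
qed

lemma ncoef_frac_d:
  assumes "\<omega> \<in> forms \<alpha> U"
  shows "ncoef (frac_d \<alpha> U \<omega>) = koszul_d (ncoef \<omega>)"
proof (intro ext)
  fix J :: "'n set" and m :: "'n \<Rightarrow> nat"
  have "phi_multi \<alpha> m * (insert_sign i J * (real (m i + 1) * phi \<alpha> (m i + 1) / phi \<alpha> (m i) * c))
      = insert_sign i J * real (m i + 1) * (phi_multi \<alpha> (m(i := m i + 1)) * c)" for i c
    using phi_multi_upd[of m i "m i + 1"] phi_pos[of "m i"] by (simp add: field_simps)
  then show "ncoef (frac_d \<alpha> U \<omega>) J m = koszul_d (ncoef \<omega>) J m"
    unfolding ncoef_def koszul_d_def expansion_coef[OF expansion_frac_d[OF assms]] sum_distrib_left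
    by (intro sum.cong) simp_all
qed

text \<open>
  Turns sums over positions in the increasing tuple \<open>I\<close> into sums over its entries: the position of
  \<open>i\<close>, counted from \<open>0\<close>, is the number of smaller elements, so \<open>(-1)\<^sup>r\<close> becomes \<open>insert_sign\<close>.
\<close>

lemma sum_sorted_positions:
  "(\<Sum>r<card I. f r (sorted_list_of_set I ! r)) = (\<Sum>i\<in>I. f (card {j \<in> I. j < i}) (i :: 'n))"
proof -
  let ?xs = "sorted_list_of_set I"
  have len: "length ?xs = card I" by simp
  have bij: "bij_betw ((!) ?xs) {..<card I} I"
    by (rule bij_betw_nth) simp_all
  have "card {j \<in> I. j < ?xs ! r} = r" if r: "r < card I" for r
  proof -
    have mono: "?xs ! s < ?xs ! t \<longleftrightarrow> s < t" if "s < card I" "t < card I" for s t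
      using that sorted_wrt_nth_less[OF strict_sorted_list_of_set, of _ _ I]
      by (metis len not_less_iff_gr_or_eq)
    have "{j \<in> I. j < ?xs ! r} = (!) ?xs ` {..<r}"
    proof -
      have "I = (!) ?xs ` {..<card I}" using bij by (simp add: bij_betw_def)
      then have "{j \<in> I. j < ?xs ! r} = (!) ?xs ` {s. s < card I \<and> ?xs ! s < ?xs ! r}" by auto
      also have "{s. s < card I \<and> ?xs ! s < ?xs ! r} = {..<r}" using mono r by auto
      finally show ?thesis .
    qed
    moreover have "inj_on ((!) ?xs) {..<r}"
      using bij r by (auto simp: bij_betw_def intro: inj_on_subset)
    ultimately show ?thesis by (simp add: card_image)
  qed
  then have "(\<Sum>r<card I. f r (?xs ! r)) = (\<Sum>r<card I. f (card {j \<in> I. j < ?xs ! r}) (?xs ! r))"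
    by (intro sum.cong) auto
  then show ?thesis
    using sum.reindex_bij_betw[OF bij, of "\<lambda>i. f (card {j \<in> I. j < i}) i"] by simp
qed

text \<open>
  The scalar with which \<open>K\<close> sends \<open>(X\<^sup>\<alpha>)\<^sup>m dX\<^sub>I\<close> to the basis element obtained by trading \<open>dX\<^sub>i\<close> for a
  further factor \<open>X\<^sub>i\<^sup>\<alpha>\<close>.
\<close>

definition homotopy_weight where
  "homotopy_weight m I i = insert_sign i I * (phi_multi \<alpha> m / phi_multi \<alpha> (m(i := m i + 1)))
     / (real (sum m UNIV) + real (card I))"

lemma homotopy_term_apply:
  "homotopy_term \<alpha> U m I J = (\<lambda>x. \<Sum>i\<in>I. homotopy_weight m I i *
     (if J = I - {i} then fmonom (m(i := m i + 1)) else 0) x)"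
proof
  fix x
  have "homotopy_term \<alpha> U m I J x = 1 / (real (sum m UNIV) + real (card I)) *
      (\<Sum>r<card I. let i = sorted_list_of_set I ! r; m' = m(i := m i + 1) in
        (- 1) ^ r * (phi_multi \<alpha> m / phi_multi \<alpha> m') * (if J = I - {i} then fmonom m' else 0) x)"
    unfolding homotopy_term_def form_scale_def sum_fun_apply Let_def form_term_def ..
  also have "\<dots> = (\<Sum>i\<in>I. homotopy_weight m I i *
     (if J = I - {i} then fmonom (m(i := m i + 1)) else 0) x)"
    unfolding Let_def
      sum_sorted_positions[of "\<lambda>r i. (- 1) ^ r * (phi_multi \<alpha> m / phi_multi \<alpha> (m(i := m i + 1)))
         * (if J = I - {i} then fmonom (m(i := m i + 1)) else 0) x" I]
    by (simp add: sum_distrib_left homotopy_weight_def insert_sign_def mult_ac)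
  finally show "homotopy_term \<alpha> U m I J x = (\<Sum>i\<in>I. homotopy_weight m I i *
     (if J = I - {i} then fmonom (m(i := m i + 1)) else 0) x)" .
qed

text \<open>
  The term of \<open>K\<close> indexed by \<open>(I, m', i)\<close> lands in \<open>(J, m)\<close> exactly when \<open>I\<close> is \<open>J\<close> with a new index
  \<open>i\<close> inserted and \<open>m'\<close> is \<open>m\<close> with its \<open>i\<close>-th exponent, necessarily positive, lowered by one. For
  given \<open>(J, m)\<close> the triple is therefore determined by \<open>i\<close>, and the triple sum collapses.
\<close>

lemma expansion_homotopy:
  assumes "\<omega> \<in> forms \<alpha> U"
  shows "expansion (homotopy \<alpha> U \<omega> J) (\<lambda>m. \<Sum>i | i \<notin> J \<and> 0 < m i.
     homotopy_weight (m(i := m i - 1)) (insert i J) i * coef (\<omega> (insert i J)) (m(i := m i - 1)))"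
proof -
  let ?S = "\<lambda>I. {m. coef (\<omega> I) m \<noteq> 0}"
  let ?\<delta> = "\<lambda>I i m m'. if J = I - {i} then if m = m'(i := m' i + 1) then 1 else 0 else (0 :: real)"
  let ?w = "\<lambda>I i m'. coef (\<omega> I) m' * homotopy_weight m' I i"
  have fin: "finite (?S I)" for I using forms_expansion[OF assms] by (simp add: expansion_def)
  have hterm: "expansion (homotopy_term \<alpha> U m' I J)
      (\<lambda>m. \<Sum>i\<in>I. homotopy_weight m' I i * ?\<delta> I i m m')" for m' I
    unfolding homotopy_term_apply
    by (intro expansion_lincomb) (auto intro: expansion_monom expansion_zero)
  have eq: "homotopy \<alpha> U \<omega> J = (\<lambda>x. \<Sum>I\<in>UNIV. 1 * (\<Sum>m'\<in>?S I. coef (\<omega> I) m' * homotopy_term \<alpha> U m' I J x))"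
    by (simp add: homotopy_def form_scale_def sum_fun_apply fun_eq_iff)
  have "expansion (homotopy \<alpha> U \<omega> J) (\<lambda>m. \<Sum>I\<in>UNIV. 1 * (\<Sum>m'\<in>?S I. coef (\<omega> I) m' *
      (\<Sum>i\<in>I. homotopy_weight m' I i * ?\<delta> I i m m')))"
    unfolding eq by (intro expansion_lincomb hterm)
  moreover have "(\<Sum>I\<in>UNIV. 1 * (\<Sum>m'\<in>?S I. coef (\<omega> I) m' *
      (\<Sum>i\<in>I. homotopy_weight m' I i * ?\<delta> I i m m')))
      = (\<Sum>i | i \<notin> J \<and> 0 < m i. ?w (insert i J) i (m(i := m i - 1)))" for m
  proof -
    let ?u = "\<lambda>i. m(i := m i - 1)"
    have cond: "i \<in> I \<and> J = I - {i} \<and> m = m'(i := m' i + 1)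
        \<longleftrightarrow> I = insert i J \<and> (i \<notin> J \<and> 0 < m i) \<and> m' = ?u i" for i I m'
      by (auto simp: fun_eq_iff)
    have "(\<Sum>i\<in>I. homotopy_weight m' I i * ?\<delta> I i m m') = (\<Sum>i\<in>UNIV.
        if i \<in> I \<and> J = I - {i} \<and> m = m'(i := m' i + 1) then homotopy_weight m' I i else 0)" for I m'
      by (simp add: sum.inter_restrict[symmetric] if_distrib cong: if_cong)
        (intro sum.mono_neutral_cong_left, auto)
    then have "(\<Sum>I\<in>UNIV. 1 * (\<Sum>m'\<in>?S I. coef (\<omega> I) m' *
        (\<Sum>i\<in>I. homotopy_weight m' I i * ?\<delta> I i m m')))
        = (\<Sum>I\<in>UNIV. \<Sum>m'\<in>?S I. \<Sum>i\<in>UNIV.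
            if I = insert i J \<and> (i \<notin> J \<and> 0 < m i) \<and> m' = ?u i then ?w I i m' else 0)"
      unfolding cond by (simp add: sum_distrib_left if_distrib cong: if_cong)
    also have "\<dots> = (\<Sum>i\<in>UNIV. \<Sum>I\<in>UNIV. \<Sum>m'\<in>?S I.
            if I = insert i J \<and> (i \<notin> J \<and> 0 < m i) \<and> m' = ?u i then ?w I i m' else 0)"
    proof -
      let ?F = "\<lambda>I m' i. if I = insert i J \<and> (i \<notin> J \<and> 0 < m i) \<and> m' = ?u i then ?w I i m' else 0"
      have "(\<Sum>I\<in>UNIV. \<Sum>m'\<in>?S I. \<Sum>i\<in>UNIV. ?F I m' i) = (\<Sum>I\<in>UNIV. \<Sum>i\<in>UNIV. \<Sum>m'\<in>?S I. ?F I m' i)"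
        by (intro sum.cong refl sum.swap)
      also have "\<dots> = (\<Sum>i\<in>UNIV. \<Sum>I\<in>UNIV. \<Sum>m'\<in>?S I. ?F I m' i)"
        by (rule sum.swap)
      finally show ?thesis .
    qed
    also have "\<dots> = (\<Sum>i\<in>UNIV. \<Sum>I\<in>UNIV. if I = insert i J then
            (if i \<notin> J \<and> 0 < m i then ?w I i (?u i) else 0) else 0)"
    proof (intro sum.cong refl)
      fix i I
      show "(\<Sum>m'\<in>?S I.
            if I = insert i J \<and> (i \<notin> J \<and> 0 < m i) \<and> m' = ?u i then ?w I i m' else 0)
          = (if I = insert i J then (if i \<notin> J \<and> 0 < m i then ?w I i (?u i) else 0) else 0)"
      proof (cases "I = insert i J \<and> i \<notin> J \<and> 0 < m i")
        case True
        then have "(\<Sum>m'\<in>?S I.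
            if I = insert i J \<and> (i \<notin> J \<and> 0 < m i) \<and> m' = ?u i then ?w I i m' else 0)
          = (\<Sum>m'\<in>?S I. if m' = ?u i then ?w I i m' else 0)" by simp
        also have "\<dots> = ?w I i (?u i)" using fin[of I] by simp
        finally show ?thesis using True by simp
      qed auto
    qed
    also have "\<dots> = (\<Sum>i\<in>UNIV. if i \<notin> J \<and> 0 < m i then ?w (insert i J) i (?u i) else 0)"
      by simp
    also have "\<dots> = (\<Sum>i | i \<notin> J \<and> 0 < m i. ?w (insert i J) i (?u i))"
      by (subst sum.inter_filter[symmetric]) simp_all
    finally show ?thesis .
  qed
  ultimately show ?thesis by (simp add: mult.commute)
qed

lemma homotopy_in_forms:
  assumes "\<omega> \<in> forms \<alpha> U"
  shows "homotopy \<alpha> U \<omega> \<in> forms \<alpha> U"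
proof -
  have "homotopy \<alpha> U \<omega> J \<in> fpoly" for J
    by (rule expansion_in_poly[OF expansion_homotopy[OF assms]])
  then show ?thesis by (simp add: forms_def)
qed

lemma ncoef_homotopy:
  assumes "\<omega> \<in> forms \<alpha> U"
  shows "ncoef (homotopy \<alpha> U \<omega>) = koszul_h (ncoef \<omega>)"
proof (intro ext)
  fix J :: "'n set" and m :: "'n \<Rightarrow> nat"
  have "phi_multi \<alpha> m * (homotopy_weight (m(i := m i - 1)) (insert i J) i * c)
      = insert_sign i J * (phi_multi \<alpha> (m(i := m i - 1)) * c) / real (sum m UNIV + card J)"
    if "i \<notin> J" "0 < m i" for i c
  proof -
    have "sum (m(i := m i - 1)) UNIV + card (insert i J) = sum m UNIV + card J"
      using sum_multiindex_upd[of m i "m i - 1"] that by simp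
    then have "real (sum (m(i := m i - 1)) UNIV) + real (card (insert i J))
        = real (sum m UNIV + card J)" by (simp only: of_nat_add[symmetric])
    moreover have "(m(i := m i - 1))(i := (m(i := m i - 1)) i + 1) = m" using that by auto
    ultimately show ?thesis
      using phi_multi_pos[of m] unfolding homotopy_weight_def by (simp del: of_nat_add)
  qed
  then show "ncoef (homotopy \<alpha> U \<omega>) J m = koszul_h (ncoef \<omega>) J m"
    unfolding ncoef_def koszul_h_def expansion_coef[OF expansion_homotopy[OF assms]]
      sum_distrib_left sum_divide_distrib
    by (intro sum.cong) auto
qed

section \<open>The homotopy formula and the cohomology\<close>

definition const_form :: "real \<Rightarrow> 'n form" where
  "const_form c = form_term (fconst U c) {}"

lemma const_form_in_forms: "const_form c \<in> forms \<alpha> U"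
  using frac_poly.const[of U c \<alpha>] frac_poly.const[of U 0 \<alpha>]
  by (simp add: forms_def const_form_def form_term_def fconst_def zero_fun_def)

lemma zero_in_forms: "0 \<in> forms \<alpha> U"
  using frac_poly.const[of U 0 \<alpha>] by (simp add: forms_def fconst_def zero_fun_def)

lemma ncoef_zero: "ncoef 0 J m = 0"
  by (simp add: ncoef_def expansion_coef[OF expansion_zero])

lemma ncoef_const_form: "ncoef (const_form c) J m = (if J = {} \<and> m = (\<lambda>_. 0) then c else 0)"
proof -
  have "phi_multi \<alpha> (\<lambda>_. 0) = 1" by (simp add: phi_multi_def phi_def)
  then show ?thesis
    by (auto simp: ncoef_def const_form_def form_term_def expansion_coef[OF expansion_zero]
        expansion_coef[OF expansion_const])
qed

lemma const_proj_eq: "const_proj \<alpha> U \<omega> = const_form (ncoef \<omega> {} (\<lambda>_. 0))"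
  by (simp add: const_proj_def const_form_def ncoef_def phi_multi_def phi_def)

lemma
  assumes "\<omega> \<in> forms \<alpha> U" "\<eta> \<in> forms \<alpha> U"
  shows forms_add: "\<omega> + \<eta> \<in> forms \<alpha> U"
    and ncoef_add: "ncoef (\<omega> + \<eta>) J m = ncoef \<omega> J m + ncoef \<eta> J m"
proof -
  have e: "expansion ((\<omega> + \<eta>) J) (\<lambda>m. coef (\<omega> J) m + coef (\<eta> J) m)" for J
    using assms by (simp add: expansion_add forms_expansion)
  show "\<omega> + \<eta> \<in> forms \<alpha> U" using expansion_in_poly[OF e] by (simp add: forms_def)
  show "ncoef (\<omega> + \<eta>) J m = ncoef \<omega> J m + ncoef \<eta> J m"
    unfolding ncoef_def expansion_coef[OF e] by (rule distrib_left)
qed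

text \<open>
  At the position of the constant \<open>0\<close>-forms the weight is \<open>0\<close> and both composites vanish: \<open>koszul_d\<close>
  is an empty sum there and no exponent can be lowered. The projection supplies exactly this
  entry.
\<close>

lemma homotopy_formula:
  assumes "\<omega> \<in> forms \<alpha> U"
  shows "frac_d \<alpha> U (homotopy \<alpha> U \<omega>) + homotopy \<alpha> U (frac_d \<alpha> U \<omega>) = \<omega> - const_proj \<alpha> U \<omega>"
  unfolding eq_diff_eq const_proj_eq
proof (rule forms_eqI)
  note closed = assms frac_d_in_forms homotopy_in_forms forms_add const_form_in_forms
  show "frac_d \<alpha> U (homotopy \<alpha> U \<omega>) + homotopy \<alpha> U (frac_d \<alpha> U \<omega>)
      + const_form (ncoef \<omega> {} (\<lambda>_. 0)) \<in> forms \<alpha> U"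
    by (intro closed)
  fix J m
  have "koszul_d (koszul_h (ncoef \<omega>)) J m + koszul_h (koszul_d (ncoef \<omega>)) J m
      + (if J = {} \<and> m = (\<lambda>_. 0) then ncoef \<omega> {} (\<lambda>_. 0) else 0) = ncoef \<omega> J m"
  proof (cases "J = {} \<and> m = (\<lambda>_. 0)")
    case True
    then show ?thesis by (simp add: koszul_d_def koszul_h_def)
  next
    case False
    then have "0 < sum m UNIV + card J" by (auto simp: card_gt_0_iff fun_eq_iff)
    from koszul_homotopy[OF this] False show ?thesis by auto
  qed
  then show "ncoef (frac_d \<alpha> U (homotopy \<alpha> U \<omega>) + homotopy \<alpha> U (frac_d \<alpha> U \<omega>)
      + const_form (ncoef \<omega> {} (\<lambda>_. 0))) J m = ncoef \<omega> J m"
    by (simp only: ncoef_add ncoef_frac_d ncoef_homotopy ncoef_const_form closed)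
qed (rule assms)

lemma frac_d_zero: "frac_d \<alpha> U 0 = 0"
  by (rule forms_eqI)
    (simp_all add: zero_in_forms frac_d_in_forms ncoef_frac_d koszul_d_def ncoef_zero)

lemma homotopy_zero: "homotopy \<alpha> U 0 = 0"
  by (rule forms_eqI)
    (simp_all add: zero_in_forms homotopy_in_forms ncoef_homotopy koszul_h_def ncoef_zero)

lemma frac_d_add:
  assumes "\<omega> \<in> forms \<alpha> U" "\<eta> \<in> forms \<alpha> U"
  shows "frac_d \<alpha> U (\<omega> + \<eta>) = frac_d \<alpha> U \<omega> + frac_d \<alpha> U \<eta>"
  using assms
  by (intro forms_eqI) (simp_all add: forms_add frac_d_in_forms ncoef_frac_d ncoef_add
    koszul_d_def distrib_left sum.distrib)

lemma forms_diff:
  assumes "\<omega> \<in> forms \<alpha> U" "\<eta> \<in> forms \<alpha> U"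
  shows "\<omega> - \<eta> \<in> forms \<alpha> U"
proof -
  have "(\<omega> - \<eta>) J \<in> fpoly" for J
  proof -
    have eq: "(\<omega> - \<eta>) J = \<omega> J + (\<lambda>x. (- 1) * \<eta> J x)" by (simp add: fun_eq_iff)
    show ?thesis
      unfolding eq using assms by (intro frac_poly.add scale_in_poly) (simp_all add: forms_def)
  qed
  then show ?thesis unfolding forms_def mem_Collect_eq by (rule allI)
qed

lemma cocycles_diff:
  assumes "\<omega> \<in> cocycles \<alpha> U p" "\<eta> \<in> cocycles \<alpha> U p"
  shows "\<omega> - \<eta> \<in> cocycles \<alpha> U p"
proof -
  have "frac_d \<alpha> U (\<omega> - \<eta>) = 0"
    using assms frac_d_add[of "\<omega> - \<eta>" \<eta>] forms_diff[of \<omega> \<eta>]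
    by (simp add: cocycles_def forms_deg_def)
  then show ?thesis using assms forms_diff[of \<omega> \<eta>] by (simp add: cocycles_def forms_deg_def)
qed

lemma zero_cocycle: "0 \<in> cocycles \<alpha> U p"
  by (simp add: cocycles_def forms_deg_def zero_in_forms frac_d_zero)

text \<open>
  Used for all \<open>J\<close> of the wrong cardinality, this shows that \<open>K\<close> lowers the form degree by one; used
  for all \<open>J\<close>, that it kills \<open>0\<close>-forms.
\<close>

lemma homotopy_vanishes:
  assumes "\<omega> \<in> forms \<alpha> U" "\<And>i. i \<notin> J \<Longrightarrow> \<omega> (insert i J) = 0"
  shows "homotopy \<alpha> U \<omega> J = 0"
proof (rule poly_eqI)
  show "homotopy \<alpha> U \<omega> J \<in> fpoly" "0 \<in> fpoly"
    using homotopy_in_forms[OF assms(1)] zero_in_forms by (simp_all add: forms_def)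
  show "coef (homotopy \<alpha> U \<omega> J) m = coef 0 m" for m
    using assms(2) by (auto simp: expansion_coef[OF expansion_homotopy[OF assms(1)]]
      expansion_coef[OF expansion_zero] intro!: sum.neutral)
qed

text \<open>
  The homotopy formula reads \<open>\<omega> = d K \<omega>\<close>, since \<open>d \<omega> = 0\<close> and a form of positive degree has no
  constant part.
\<close>

lemma cocycle_is_coboundary:
  assumes "\<omega> \<in> cocycles \<alpha> U (Suc p)"
  shows "\<omega> \<in> coboundaries \<alpha> U (Suc p)"
proof -
  have \<omega>: "\<omega> \<in> forms \<alpha> U" "frac_d \<alpha> U \<omega> = 0" and deg: "\<And>I. card I \<noteq> Suc p \<Longrightarrow> \<omega> I = 0"
    using assms by (auto simp: cocycles_def forms_deg_def)
  have "\<omega> {} = 0" using deg by simp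
  then have "ncoef \<omega> {} (\<lambda>_. 0) = 0" by (simp add: ncoef_def expansion_coef[OF expansion_zero])
  then have "const_proj \<alpha> U \<omega> = 0"
    by (simp add: const_proj_eq const_form_def form_term_def fconst_def fun_eq_iff)
  then have "\<omega> = frac_d \<alpha> U (homotopy \<alpha> U \<omega>)"
    using homotopy_formula[OF \<omega>(1)] \<omega>(2) by (simp add: homotopy_zero)
  moreover have "homotopy \<alpha> U \<omega> \<in> forms_deg \<alpha> U p"
    using homotopy_in_forms[OF \<omega>(1)]
    by (auto simp: forms_deg_def intro!: homotopy_vanishes[OF \<omega>(1)] deg)
  ultimately show ?thesis by auto
qed

text \<open>
  Differences of cocycles are cocycles, hence coboundaries, so every class is the whole space of
  cocycles.
\<close>

lemma cohomology_positive: "cohomology \<alpha> U (Suc p) = {cohom_zero \<alpha> U (Suc p)}"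
proof -
  have "cohom_rel \<alpha> U (Suc p) `` {\<omega>} = cocycles \<alpha> U (Suc p)" if "\<omega> \<in> cocycles \<alpha> U (Suc p)" for \<omega>
    using that cocycle_is_coboundary[OF cocycles_diff[OF that]]
    by (auto simp: cohom_rel_def simp del: coboundaries.simps)
  then show ?thesis using zero_cocycle[of "Suc p"]
    by (auto simp: cohomology_def quotient_def cohom_zero_def)
qed

lemma const_form_cocycle: "const_form c \<in> cocycles \<alpha> U 0"
proof -
  have "frac_d \<alpha> U (const_form c) = 0"
  proof (rule forms_eqI)
    show "ncoef (frac_d \<alpha> U (const_form c)) J m = ncoef 0 J m" for J m
      unfolding ncoef_frac_d[OF const_form_in_forms] ncoef_zero koszul_d_def ncoef_const_form
      by (auto simp: fun_eq_iff intro!: sum.neutral)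
  qed (simp_all add: zero_in_forms frac_d_in_forms const_form_in_forms)
  then show ?thesis
    using const_form_in_forms by (auto simp: cocycles_def forms_deg_def const_form_def form_term_def)
qed

text \<open>
  For a closed \<open>0\<close>-form both terms on the left of the homotopy formula vanish, and the form equals
  its constant part.
\<close>

lemma cocycles_zero: "cocycles \<alpha> U 0 = range const_form"
proof
  show "cocycles \<alpha> U 0 \<subseteq> range const_form"
  proof
    fix \<omega> assume "\<omega> \<in> cocycles \<alpha> U 0"
    then have \<omega>: "\<omega> \<in> forms \<alpha> U" "frac_d \<alpha> U \<omega> = 0" and deg: "\<And>I. card I \<noteq> 0 \<Longrightarrow> \<omega> I = 0"
      by (auto simp: cocycles_def forms_deg_def)
    have "homotopy \<alpha> U \<omega> = 0"
      using homotopy_vanishes[OF \<omega>(1) deg] by (simp add: fun_eq_iff)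
    then have "\<omega> = const_proj \<alpha> U \<omega>"
      using homotopy_formula[OF \<omega>(1)] \<omega>(2) by (simp add: homotopy_zero frac_d_zero)
    then show "\<omega> \<in> range const_form" by (metis const_proj_eq rangeI)
  qed
qed (auto simp: const_form_cocycle)

text \<open>
  There are no nonzero coboundaries in degree \<open>0\<close>, so cohomology classes are singletons.
\<close>

lemma cohom_rel_zero: "cohom_rel \<alpha> U 0 `` {const_form c} = {const_form c}"
  using const_form_cocycle by (auto simp: cohom_rel_def)

lemma cohomology_zero: "cohomology \<alpha> U 0 = range (\<lambda>c. {const_form c})"
  by (auto simp: cohomology_def quotient_def cocycles_zero cohom_rel_zero)

lemma inj_const_form: "inj (\<lambda>c. {const_form c})"
proof (rule injI)
  fix c c' assume "{const_form c} = {const_form c'}"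
  then have "const_form c {} b = const_form c' {} b" by simp
  then show "c = c'" using b_in_U by (simp add: const_form_def form_term_def fconst_def)
qed

lemma cohom_add_const_form:
  "cohom_add \<alpha> U 0 {const_form c} {const_form c'} = {const_form (c + c')}"
proof -
  have "const_form c + const_form c' = const_form (c + c')"
    by (auto simp: const_form_def form_term_def fconst_def fun_eq_iff)
  then show ?thesis by (simp add: cohom_add_def cohom_rel_zero)
qed

lemma cohom_scale_const_form: "cohom_scale \<alpha> U 0 a {const_form c} = {const_form (a * c)}"
proof -
  have "form_scale a (const_form c) = const_form (a * c)"
    by (auto simp: form_scale_def const_form_def form_term_def fconst_def fun_eq_iff)
  then show ?thesis by (simp add: cohom_scale_def cohom_rel_zero)
qed

lemma cohomology_zero_iso:
  "\<exists>F :: 'n form set \<Rightarrow> real.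
     bij_betw F (cohomology \<alpha> U 0) UNIV \<and>
     (\<forall>A\<in>cohomology \<alpha> U 0. \<forall>B\<in>cohomology \<alpha> U 0. F (cohom_add \<alpha> U 0 A B) = F A + F B) \<and>
     (\<forall>c. \<forall>A\<in>cohomology \<alpha> U 0. F (cohom_scale \<alpha> U 0 c A) = c * F A)"
proof -
  let ?F = "inv (\<lambda>c. {const_form c})"
  have "bij_betw ?F (cohomology \<alpha> U 0) UNIV"
    unfolding cohomology_zero by (rule bij_betw_inv_into) (simp add: bij_betw_def inj_const_form)
  moreover have "?F {const_form c} = c" for c
    by (rule inv_f_f[OF inj_const_form])
  ultimately show ?thesis
    by (intro exI[of _ ?F]) (auto simp: cohomology_zero cohom_add_const_form cohom_scale_const_form)
qed

end

theorem theorem6p4: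
  fixes \<alpha> :: real
    and b :: "real ^ 'n::{finite,linorder}"
    and U :: "(real ^ 'n::{finite,linorder}) set"
  assumes "0 < \<alpha>" and "\<alpha> < 1"
    and "\<And>i. 0 < b $ i"
    and "U = cbox 0 b"
  shows "(\<forall>\<omega>\<in>forms \<alpha> U.
            frac_d \<alpha> U (homotopy \<alpha> U \<omega>) + homotopy \<alpha> U (frac_d \<alpha> U \<omega>)
              = \<omega> - const_proj \<alpha> U \<omega>) \<and>
         (\<exists>F :: 'n form set \<Rightarrow> real.
            bij_betw F (cohomology \<alpha> U 0) UNIV \<and>
            (\<forall>A\<in>cohomology \<alpha> U 0. \<forall>B\<in>cohomology \<alpha> U 0.
               F (cohom_add \<alpha> U 0 A B) = F A + F B) \<and>
            (\<forall>c. \<forall>A\<in>cohomology \<alpha> U 0. F (cohom_scale \<alpha> U 0 c A) = c * F A)) \<and>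
         (\<forall>p\<ge>1. cohomology \<alpha> U p = {cohom_zero \<alpha> U p})"
proof -
  interpret frac_box \<alpha> b U using assms by unfold_locales auto
  have "cohomology \<alpha> U p = {cohom_zero \<alpha> U p}" if "p \<ge> 1" for p
    using that cohomology_positive[of "p - 1"] by simp
  then show ?thesis using homotopy_formula cohomology_zero_iso by blast
qed

end
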